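(* Let $Q\subset\otimes_{i=1}^{l}\mathbb{R}^{d_{i}}$ be a $0$-symmetric convex body. The following are equivalent: (1) $Q$ is a tensorial body in $\otimes_{i=1}^{l}\mathbb{R}^{d_{i}}$. (2) For any decomposable vector $a^{1}\otimes\cdots\otimes a^{l}\in\partial Q$, $$Q_{1}^{a^{1},\ldots,a^{l}}\otimes_{\pi}\cdots\otimes_{\pi}Q_{l}^{a^{1},\ldots, a^{l}}\subseteq Q\subseteq Q_{1}^{a^{1},\ldots,a^{l}}\otimes_{\epsilon}\cdots\otimes_{\epsilon}Q_{l}^{a^{1},\ldots,a^{l}}.$$ (3) There exist norms $\left\Vert \cdot\right\Vert _{i}$ on $\mathbb{R}^{d_{i}}$, $i=1,\ldots,l$, such that $g_{Q}$ is a reasonable crossnorm on $\otimes_{i=1}^{l}\left(\mathbb{R}^{d_{i}},\left\Vert \cdot\right\Vert _{i}\right)$. In this case (with $\|\cdot\|_i$ norms as in (3) and $a^1\otimes\cdots\otimes a^l\in\partial Q$), $g_{Q_{i}^{a^{1},\ldots,a^{l}}}\left(\cdot\right)=\frac{1}{\left\Vert a^{i}\right\Vert _{i}}\left\Vert\cdot\right\Vert _{i}$ for $i=1,\ldots,l$.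
   Context: Here $l$ and $d_1,\dots,d_l$ are positive integers. $\langle\cdot,\cdot\rangle$ is the standard scalar product on $\mathbb{R}^{d}$, and $\langle\cdot,\cdot\rangle_H$ is the scalar product on $\otimes_{i=1}^l\mathbb{R}^{d_i}$ determined by $\langle x^1\otimes\cdots\otimes x^l,y^1\otimes\cdots\otimes y^l\rangle_H=\prod_{i=1}^l\langle x^i,y^i\rangle$. In a Euclidean space $\mathbb{E}$, a convex body is a compact convex set with nonempty interior; it is $0$-symmetric if $P=-P$. The polar set of a nonempty $C\subset\mathbb{E}$ is $C^\circ=\{y\in\mathbb{E}:\sup_{x\in C}|\langle x,y\rangle_{\mathbb{E}}|\le 1\}$ (with $\langle\cdot,\cdot\rangle$ in $\mathbb{R}^{d_i}$ and $\langle\cdot,\cdot\rangle_H$ in the tensor product). The Minkowski functional of a $0$-symmetric convex body $P$ is $g_P(x)=\inf\{\lambda>0:\lambda^{-1}x\in P\}$. For $0$-symmetric convex bodies $Q_i\subset\mathbb{R}^{d_i}$: $Q_1\otimes_\pi\cdots\otimes_\pi Q_l:=\mathrm{conv}\{x^1\otimes\cdots\otimes x^l:x^i\in Q_i,\ i=1,\dots,l\}$ and $Q_1\otimes_\epsilon\cdots\otimes_\epsilon Q_l:=(Q_1^\circ\otimes_\pi\cdots\otimes_\pi Q_l^\circ)^\circ$. A $0$-symmetric convex body $Q\subset\otimes_{i=1}^l\mathbb{R}^{d_i}$ is a tensorial body in $\otimes_{i=1}^l\mathbb{R}^{d_i}$ if there exist $0$-symmetric convex bodies $Q_i\subset\mathbb{R}^{d_i}$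 with $Q_{1}\otimes_{\pi}\cdots\otimes_{\pi}Q_{l}\subseteq Q\subseteq Q_{1}\otimes_{\epsilon}\cdots\otimes_{\epsilon}Q_{l}$. For a $0$-symmetric convex body $Q\subset\otimes_{i=1}^l\mathbb{R}^{d_i}$ and a non-zero decomposable vector $a^1\otimes\cdots\otimes a^l$, $Q_{i}^{a^{1},\ldots,a^{l}}:=\{ x^{i}\in\mathbb{R}^{d_{i}}:a^{1}\otimes\cdots\otimes a^{i-1}\otimes x^{i}\otimes a^{i+1}\otimes\cdots\otimes a^{l}\in Q\}$, a $0$-symmetric convex body in $\mathbb{R}^{d_i}$. A norm $\alpha$ on the tensor product $\otimes_{i=1}^l X_i$ of normed spaces is a reasonable crossnorm if (1) $\alpha(x^1\otimes\cdots\otimes x^l)\le\|x^1\|\cdots\|x^l\|$ for all $x^i\in X_i$, and (2) for all $x_i^*\in X_i^*$, $x_1^*\otimes\cdots\otimes x_l^*\in(\otimes_{i=1}^lX_i,\alpha)^*$ and its dual norm is at most $\|x_1^*\|\cdots\|x_l^*\|$. *)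

theory Defs
  imports "HOL-Analysis.Analysis"
begin

section \<open>Tensor products of coordinate spaces\<close>

text \<open>
  The number of factors is \<open>l = CARD('l)\<close>.  The dimensions \<open>d\<^sub>i\<close> may differ from factor to factor,
  so they are not types: for a family \<open>D :: 'l \<Rightarrow> 'n set\<close> of index sets, the \<open>i\<close>-th factor is the
  coordinate space over \<open>D i\<close>, of dimension \<open>d\<^sub>i = card (D i)\<close>, realised as the vectors of
  \<open>real ^ 'n\<close> that vanish outside \<open>D i\<close>.  Since \<open>'l\<close>, \<open>'n\<close> and \<open>D\<close> are arbitrary, every list of
  positive dimensions occurs.  The tensor product of the factors consists of the multi-arrays indexed
  by the \<open>k\<close> with \<open>k i \<in> D i\<close> for all \<open>i\<close>, realised inside \<open>real ^ ('l \<Rightarrow> 'n)\<close>.  All scalar products and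
  topologies are the ones induced from the ambient Euclidean spaces; topological notions (interior,
  boundary) are always taken relative to the subspace.
\<close>

definition coord_space :: "'n set \<Rightarrow> (real ^ 'n) set" where
  "coord_space S = {x. \<forall>j. j \<notin> S \<longrightarrow> x $ j = 0}"

definition tensor_space :: "('l::finite \<Rightarrow> 'n::finite set) \<Rightarrow> (real ^ ('l \<Rightarrow> 'n)) set" where
  "tensor_space D = coord_space {k. \<forall>i. k i \<in> D i}"

definition tensor_vec :: "('l::finite \<Rightarrow> real ^ 'n::finite) \<Rightarrow> real ^ ('l \<Rightarrow> 'n)" where
  "tensor_vec x = (\<chi> k. \<Prod>i\<in>UNIV. x i $ k i)"

text \<open>
  The lemmas of this section confirm the model: the decomposable vectors span the tensor space, and the
  Euclidean scalar product is the one called \<open>\<langle>\<cdot>,\<cdot>\<rangle>\<^sub>H\<close>, determined by its values on decomposable vectors.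
\<close>

lemma tensor_vec_in_tensor_space:
  fixes D :: "'l::finite \<Rightarrow> 'n::finite set"
  assumes "\<And>i. x i \<in> coord_space (D i)"
  shows "tensor_vec x \<in> tensor_space D"
proof -
  have "(\<Prod>i\<in>UNIV. x i $ k i) = 0" if "k i0 \<notin> D i0" for k i0
    using assms[of i0] that by (auto simp: coord_space_def intro!: prod_zero)
  then show ?thesis
    by (auto simp: tensor_space_def coord_space_def tensor_vec_def)
qed

lemma inner_tensor_vec:
  fixes x y :: "'l::finite \<Rightarrow> real ^ 'n::finite"
  shows "tensor_vec x \<bullet> tensor_vec y = (\<Prod>i\<in>UNIV. x i \<bullet> y i)"
proof -
  have "(\<Prod>i\<in>UNIV. x i \<bullet> y i) = (\<Sum>k\<in>PiE UNIV (\<lambda>i. UNIV). \<Prod>i\<in>UNIV. x i $ k i * y i $ k i)"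
    by (simp add: inner_vec_def prod_sum_PiE)
  then show ?thesis
    by (simp add: inner_vec_def tensor_vec_def prod.distrib)
qed

lemma axis_eq_tensor_vec:
  fixes k :: "'l::finite \<Rightarrow> 'n::finite"
  shows "axis k 1 = tensor_vec (\<lambda>i. axis (k i) 1)"
proof -
  have "(\<Prod>i\<in>UNIV. axis (k i) (1::real) $ m i) = (if m = k then 1 else 0)" for m
  proof (cases "m = k")
    case False
    then obtain i where "m i \<noteq> k i" by blast
    then show ?thesis
      using False by (auto simp: axis_def intro!: prod_zero)
  qed (simp add: axis_def)
  then show ?thesis
    by (simp add: tensor_vec_def vec_eq_iff axis_def)
qed

lemma span_tensor_vec:
  fixes D :: "'l::finite \<Rightarrow> 'n::finite set"
  shows "span {tensor_vec x |x. \<forall>i. x i \<in> coord_space (D i)} = tensor_space D" (is "span ?S = _")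
proof
  have "subspace (tensor_space D)"
    by (auto simp: subspace_def tensor_space_def coord_space_def)
  moreover have "?S \<subseteq> tensor_space D"
    by (auto intro!: tensor_vec_in_tensor_space)
  ultimately show "span ?S \<subseteq> tensor_space D"
    by (intro span_minimal)
  show "tensor_space D \<subseteq> span ?S"
  proof
    fix t assume t: "t \<in> tensor_space D"
    have "t $ k *\<^sub>R axis k 1 \<in> span ?S" for k
    proof (cases "\<forall>i. k i \<in> D i")
      case True
      then have "axis k 1 \<in> ?S"
        unfolding axis_eq_tensor_vec by (force simp: coord_space_def axis_def)
      then show ?thesis by (intro span_scale span_base)
    next
      case False
      then have "t $ k = 0" using t by (auto simp: tensor_space_def coord_space_def)
      then show ?thesis by (simp add: span_zero)
    qed
    then have "(\<Sum>k\<in>UNIV. t $ k *\<^sub>R axis k 1) \<in> span ?S" by (intro span_sum)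
    moreover have "(\<Sum>k\<in>UNIV. t $ k *\<^sub>R axis k 1) = t"
      by (simp add: vec_eq_iff axis_def if_distrib cong: if_cong)
    ultimately show "t \<in> span ?S" by simp
  qed
qed


section \<open>Convex bodies in a subspace of a Euclidean space\<close>

definition sym_convex_body :: "'a::euclidean_space set \<Rightarrow> 'a set \<Rightarrow> bool" where
  "sym_convex_body V P \<longleftrightarrow> P \<subseteq> V \<and> compact P \<and> convex P \<and>
     (top_of_set V) interior_of P \<noteq> {} \<and> P = uminus ` P"

text \<open>The supremum is taken in the extended reals because \<open>C\<close> may be unbounded.\<close>

definition polar :: "'a::euclidean_space set \<Rightarrow> 'a set \<Rightarrow> 'a set" where
  "polar V C = {y \<in> V. (SUP x\<in>C. ereal \<bar>x \<bullet> y\<bar>) \<le> 1}"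

definition minkowski_functional :: "'a::real_vector set \<Rightarrow> 'a \<Rightarrow> real" where
  "minkowski_functional P x = Inf {r. 0 < r \<and> inverse r *\<^sub>R x \<in> P}"

definition proj_tensor :: "('l::finite \<Rightarrow> (real ^ 'n::finite) set) \<Rightarrow> (real ^ ('l \<Rightarrow> 'n)) set" where
  "proj_tensor Q = convex hull {tensor_vec x |x. \<forall>i. x i \<in> Q i}"

definition inj_tensor ::
  "('l::finite \<Rightarrow> 'n::finite set) \<Rightarrow> ('l \<Rightarrow> (real ^ 'n) set) \<Rightarrow> (real ^ ('l \<Rightarrow> 'n)) set" where
  "inj_tensor D Q = polar (tensor_space D) (proj_tensor (\<lambda>i. polar (coord_space (D i)) (Q i)))"

definition tensorial_body ::
  "('l::finite \<Rightarrow> 'n::finite set) \<Rightarrow> (real ^ ('l \<Rightarrow> 'n)) set \<Rightarrow> bool" where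
  "tensorial_body D Q \<longleftrightarrow> sym_convex_body (tensor_space D) Q \<and>
     (\<exists>P. (\<forall>i. sym_convex_body (coord_space (D i)) (P i)) \<and>
          proj_tensor P \<subseteq> Q \<and> Q \<subseteq> inj_tensor D P)"

definition slice ::
  "('l::finite \<Rightarrow> 'n::finite set) \<Rightarrow> (real ^ ('l \<Rightarrow> 'n)) set \<Rightarrow> ('l \<Rightarrow> real ^ 'n) \<Rightarrow> 'l \<Rightarrow> (real ^ 'n) set"
  where "slice D Q a i = {x \<in> coord_space (D i). tensor_vec (a(i := x)) \<in> Q}"


section \<open>Norms, dual norms and reasonable crossnorms\<close>

text \<open>
  Norms and functionals on a subspace \<open>V\<close> are given by functions on the ambient space, of which only
  the restriction to \<open>V\<close> matters.
\<close>

definition norm_on :: "'a::real_vector set \<Rightarrow> ('a \<Rightarrow> real) \<Rightarrow> bool" where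
  "norm_on V N \<longleftrightarrow>
     (\<forall>x\<in>V. 0 \<le> N x \<and> (N x = 0 \<longleftrightarrow> x = 0)) \<and>
     (\<forall>x\<in>V. \<forall>c. N (c *\<^sub>R x) = \<bar>c\<bar> * N x) \<and>
     (\<forall>x\<in>V. \<forall>y\<in>V. N (x + y) \<le> N x + N y)"

definition in_dual :: "'a::real_vector set \<Rightarrow> ('a \<Rightarrow> real) \<Rightarrow> ('a \<Rightarrow> real) \<Rightarrow> bool" where
  "in_dual V N f \<longleftrightarrow>
     (\<forall>x\<in>V. \<forall>y\<in>V. f (x + y) = f x + f y) \<and>
     (\<forall>x\<in>V. \<forall>c. f (c *\<^sub>R x) = c * f x) \<and>
     (\<exists>C. \<forall>x\<in>V. \<bar>f x\<bar> \<le> C * N x)"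

definition dual_norm :: "'a::real_vector set \<Rightarrow> ('a \<Rightarrow> real) \<Rightarrow> ('a \<Rightarrow> real) \<Rightarrow> real" where
  "dual_norm V N f = (SUP x\<in>{x \<in> V. N x \<le> 1}. \<bar>f x\<bar>)"

text \<open>
  \<open>tensor_functional f\<close> is the linear functional taking the value \<open>\<Prod>i. f i (x i)\<close> on each decomposable
  vector (lemma below); it is given here by its coordinates.
\<close>

definition tensor_functional ::
  "('l::finite \<Rightarrow> real ^ 'n::finite \<Rightarrow> real) \<Rightarrow> real ^ ('l \<Rightarrow> 'n) \<Rightarrow> real" where
  "tensor_functional f t = (\<Sum>k\<in>UNIV. t $ k * (\<Prod>i\<in>UNIV. f i (axis (k i) 1)))"

lemma linear_tensor_functional: "linear (tensor_functional f)"
  by (rule linearI)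
    (simp_all add: tensor_functional_def ring_distribs sum.distrib sum_distrib_left mult.assoc)

lemma in_dual_sum:
  assumes f: "in_dual V N f" and V: "subspace V" and "finite A" and "\<And>j. j \<in> A \<Longrightarrow> g j \<in> V"
  shows "f (\<Sum>j\<in>A. g j) = (\<Sum>j\<in>A. f (g j))"
  using assms(3,4)
proof (induction A rule: finite_induct)
  case empty
  have "f (0 *\<^sub>R 0) = 0 * f 0"
    using f V unfolding in_dual_def by (metis subspace_0)
  then show ?case by simp
next
  case (insert j A)
  then have "g j \<in> V" "(\<Sum>j\<in>A. g j) \<in> V"
    using V by (auto intro: subspace_sum)
  with insert f show ?case by (auto simp: in_dual_def)
qed

lemma tensor_functional_tensor_vec:
  fixes D :: "'l::finite \<Rightarrow> 'n::finite set"
  assumes f: "\<And>i. in_dual (coord_space (D i)) (N i) (f i)"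
    and x: "\<And>i. x i \<in> coord_space (D i)"
  shows "tensor_functional f (tensor_vec x) = (\<Prod>i\<in>UNIV. f i (x i))"
proof -
  have "f i (x i) = (\<Sum>j\<in>UNIV. x i $ j * f i (axis j 1))" for i
  proof -
    have sub: "subspace (coord_space (D i))"
      by (auto simp: subspace_def coord_space_def)
    have ax: "axis j 1 \<in> coord_space (D i)" if "j \<in> D i" for j
      using that by (auto simp: coord_space_def axis_def)
    have zero: "x i $ j = 0" if "j \<notin> D i" for j
      using x[of i] that by (simp add: coord_space_def)
    have "x i = (\<Sum>j\<in>UNIV. x i $ j *\<^sub>R axis j 1)"
      by (simp add: vec_eq_iff axis_def if_distrib cong: if_cong)
    also have "\<dots> = (\<Sum>j\<in>D i. x i $ j *\<^sub>R axis j 1)"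
      by (rule sum.mono_neutral_right) (auto simp: zero)
    finally have "f i (x i) = f i (\<Sum>j\<in>D i. x i $ j *\<^sub>R axis j 1)" by simp
    also have "\<dots> = (\<Sum>j\<in>D i. f i (x i $ j *\<^sub>R axis j 1))"
      by (rule in_dual_sum[OF f sub]) (auto intro: subspace_scale[OF sub] ax)
    also have "\<dots> = (\<Sum>j\<in>D i. x i $ j * f i (axis j 1))"
      using f[of i] ax by (intro sum.cong) (auto simp: in_dual_def)
    also have "\<dots> = (\<Sum>j\<in>UNIV. x i $ j * f i (axis j 1))"
      by (rule sum.mono_neutral_left) (auto simp: zero)
    finally show ?thesis .
  qed
  then have "(\<Prod>i\<in>UNIV. f i (x i))
      = (\<Sum>k\<in>PiE UNIV (\<lambda>i. UNIV). \<Prod>i\<in>UNIV. x i $ k i * f i (axis (k i) 1))"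
    by (simp add: prod_sum_PiE)
  then show ?thesis
    by (simp add: tensor_functional_def tensor_vec_def prod.distrib)
qed

definition reasonable_crossnorm ::
  "('l::finite \<Rightarrow> 'n::finite set) \<Rightarrow> ('l \<Rightarrow> real ^ 'n \<Rightarrow> real) \<Rightarrow> (real ^ ('l \<Rightarrow> 'n) \<Rightarrow> real) \<Rightarrow> bool"
  where "reasonable_crossnorm D N \<alpha> \<longleftrightarrow>
     norm_on (tensor_space D) \<alpha> \<and>
     (\<forall>x. (\<forall>i. x i \<in> coord_space (D i)) \<longrightarrow> \<alpha> (tensor_vec x) \<le> (\<Prod>i\<in>UNIV. N i (x i))) \<and>
     (\<forall>f. (\<forall>i. in_dual (coord_space (D i)) (N i) (f i)) \<longrightarrow>
        in_dual (tensor_space D) \<alpha> (tensor_functional f) \<and>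
        dual_norm (tensor_space D) \<alpha> (tensor_functional f)
          \<le> (\<Prod>i\<in>UNIV. dual_norm (coord_space (D i)) (N i) (f i)))"

end

theory Submission
  imports Defs
begin

text \<open>
  Symmetric convex bodies and norms on a subspace are the same data: a norm gives its unit ball, and a
  body gives its Minkowski functional \<open>g\<close>.  Under this dictionary the two inclusions defining a
  tensorial body become the two axioms of a reasonable crossnorm.  Let \<open>P\<^sub>i\<close> be the unit ball of
  \<open>N\<^sub>i\<close>.  The left inclusion says that \<open>g\<^sub>Q (x\<^sub>1 \<otimes> \<dots> \<otimes> x\<^sub>l) \<le> 1\<close> whenever all \<open>N\<^sub>i x\<^sub>i \<le> 1\<close>, which by
  homogeneity is the first axiom.  The right inclusion says that \<open>y\<^sub>1 \<otimes> \<dots> \<otimes> y\<^sub>l\<close> is bounded by 1 on \<open>Q\<close>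
  whenever each \<open>y\<^sub>i\<close> lies in the polar of \<open>P\<^sub>i\<close>.  As every functional on \<open>\<real>\<^sup>d\<close> is given by a vector,
  this is the second axiom.  Hence \<open>reasonable_crossnorm_iff_between\<close>, and with it the equivalence of
  tensoriality with the existence of the norms.

  Everything else follows from the fact that a reasonable crossnorm is exactly multiplicative on
  decomposable vectors, \<open>g\<^sub>Q (x\<^sub>1 \<otimes> \<dots> \<otimes> x\<^sub>l) = \<Prod>\<^sub>i N\<^sub>i x\<^sub>i\<close>
  (\<open>reasonable_crossnorm_tensor_vec\<close>).  The lower bound comes from testing against a product of
  norming functionals of the \<open>x\<^sub>i\<close>, which a separation argument provides.  On the boundary,
  \<open>\<Prod>\<^sub>i N\<^sub>i a\<^sub>i = 1\<close>, so the \<open>i\<close>-th slice through \<open>a\<close> is the unit ball of \<open>N\<^sub>i / N\<^sub>i a\<^sub>i\<close>.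
  This is the formula for the functional of the slice, and it shows that the slices are dilates of the
  \<open>P\<^sub>i\<close> whose factors \<open>N\<^sub>i a\<^sub>i\<close> have product 1.  Such factors cancel in both inclusions, so the slices
  enclose \<open>Q\<close> whenever the \<open>P\<^sub>i\<close> do.  Conversely, if the slices enclose \<open>Q\<close>, then \<open>Q\<close> is tensorial,
  because slices are symmetric convex bodies and a decomposable boundary point exists.
\<close>

section \<open>Norms and symmetric convex bodies\<close>

definition unit_ball :: "'a::real_vector set \<Rightarrow> ('a \<Rightarrow> real) \<Rightarrow> 'a set" where
  "unit_ball V N = {x \<in> V. N x \<le> 1}"

lemma norm_on_nonneg: "norm_on V N \<Longrightarrow> x \<in> V \<Longrightarrow> 0 \<le> N x"
  and norm_on_eq_0_iff: "norm_on V N \<Longrightarrow> x \<in> V \<Longrightarrow> N x = 0 \<longleftrightarrow> x = 0"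
  and norm_on_scale: "norm_on V N \<Longrightarrow> x \<in> V \<Longrightarrow> N (c *\<^sub>R x) = \<bar>c\<bar> * N x"
  and norm_on_triangle: "norm_on V N \<Longrightarrow> x \<in> V \<Longrightarrow> y \<in> V \<Longrightarrow> N (x + y) \<le> N x + N y"
  by (auto simp: norm_on_def)

lemma norm_on_pos: "norm_on V N \<Longrightarrow> x \<in> V \<Longrightarrow> x \<noteq> 0 \<Longrightarrow> 0 < N x"
  using norm_on_nonneg[of V N x] norm_on_eq_0_iff[of V N x] by linarith

lemma norm_on_sum:
  assumes N: "norm_on V N" and V: "subspace V" and "finite A" and "\<And>j. j \<in> A \<Longrightarrow> g j \<in> V"
  shows "N (\<Sum>j\<in>A. g j) \<le> (\<Sum>j\<in>A. N (g j))"
  using assms(3,4)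
proof (induction A rule: finite_induct)
  case empty
  then show ?case using norm_on_eq_0_iff[OF N subspace_0[OF V]] by simp
next
  case (insert j A)
  then have "g j \<in> V" "(\<Sum>j\<in>A. g j) \<in> V"
    using V by (auto intro: subspace_sum)
  from norm_on_triangle[OF N this] insert show ?case by simp
qed

text \<open>
  Estimates are checked on unit balls and transferred to the whole space by homogeneity.  The
  map \<open>f\<close> is either a scalar product with a fixed vector or a functional in \<^const>\<open>in_dual\<close>, which is
  homogeneous on \<open>V\<close> alone.
\<close>
lemma bounded_on_unit_ball_imp:
  assumes N: "norm_on V N" and V: "subspace V" and x: "x \<in> V"
    and scale: "\<And>z c. z \<in> V \<Longrightarrow> f (c *\<^sub>R z) = c * f z"
    and bound: "\<And>z. z \<in> unit_ball V N \<Longrightarrow> \<bar>f z\<bar> \<le> c"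
  shows "\<bar>f x\<bar> \<le> c * N x"
proof (cases "x = 0")
  case True
  then have "f x = 0" "N x = 0" using scale[OF x, of 0] norm_on_eq_0_iff[OF N x] by auto
  then show ?thesis by simp
next
  case False
  then have pos: "0 < N x" using N x by (rule_tac norm_on_pos)
  have "inverse (N x) *\<^sub>R x \<in> unit_ball V N"
    using pos x V by (simp add: unit_ball_def subspace_scale norm_on_scale[OF N x])
  from bound[OF this] have "\<bar>inverse (N x) * f x\<bar> \<le> c" using scale[OF x] by simp
  then show ?thesis using pos by (simp add: abs_mult field_simps)
qed

text \<open>
  This bound and \<open>norm_le_norm_on\<close> below say that all norms on a finite-dimensional space are
  equivalent.  Here one expands \<open>x\<close> in an orthonormal basis of \<open>V\<close>, and the sum of the norms of the
  basis vectors serves as the constant.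
\<close>
lemma norm_on_le_norm:
  fixes V :: "'a::euclidean_space set"
  assumes N: "norm_on V N" and V: "subspace V"
  obtains C where "0 < C" "\<And>x. x \<in> V \<Longrightarrow> N x \<le> C * norm x"
proof -
  obtain B where B: "B \<subseteq> V" "pairwise orthogonal B" "\<And>x. x \<in> B \<Longrightarrow> norm x = 1"
    "independent B" "span B = V"
    using orthonormal_basis_subspace[OF V] by metis
  have fin: "finite B" using B(4) by (rule independent_imp_finite)
  \<comment> \<open>adding 1 keeps the constant positive when \<open>V\<close> is trivial\<close>
  define C where "C = (\<Sum>b\<in>B. N b) + 1"
  have nn: "0 \<le> (\<Sum>b\<in>B. N b)" using B(1) norm_on_nonneg[OF N] by (intro sum_nonneg) blast
  have "N x \<le> C * norm x" if x: "x \<in> V" for x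
  proof -
    have "x = (\<Sum>b\<in>B. (x \<bullet> b) *\<^sub>R b)"
      using orthonormal_basis_expand[OF B(2) B(3) _ fin] x B(5) by simp
    then have "N x \<le> (\<Sum>b\<in>B. N ((x \<bullet> b) *\<^sub>R b))"
      using norm_on_sum[OF N V fin, of "\<lambda>b. (x \<bullet> b) *\<^sub>R b"] B(1) V by (simp add: subset_iff subspace_scale)
    also have "\<dots> \<le> (\<Sum>b\<in>B. N b * norm x)"
    proof (rule sum_mono)
      fix b assume b: "b \<in> B"
      then have "\<bar>x \<bullet> b\<bar> \<le> norm x" using Cauchy_Schwarz_ineq2[of x b] B(3) by simp
      moreover have "b \<in> V" using b B(1) by blast
      ultimately show "N ((x \<bullet> b) *\<^sub>R b) \<le> N b * norm x"
        using norm_on_nonneg[OF N] by (simp add: norm_on_scale[OF N] mult.commute mult_left_mono)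
    qed
    also have "\<dots> \<le> C * norm x" by (simp add: C_def distrib_right flip: sum_distrib_right)
    finally show ?thesis .
  qed
  with nn show thesis by (intro that[of C]) (auto simp: C_def)
qed

lemma continuous_on_norm_on:
  fixes V :: "'a::euclidean_space set"
  assumes N: "norm_on V N" and V: "subspace V"
  shows "continuous_on V N"
proof -
  obtain C where C: "0 < C" "\<And>x. x \<in> V \<Longrightarrow> N x \<le> C * norm x"
    using norm_on_le_norm[OF N V] by blast
  have le: "N x - N y \<le> C * dist x y" if "x \<in> V" "y \<in> V" for x y
  proof -
    have "x - y \<in> V" using that V by (simp add: subspace_diff)
    then show ?thesis
      using norm_on_triangle[OF N, of "x - y" y] that C(2)[of "x - y"] by (simp add: dist_norm)
  qed
  have "C-lipschitz_on V N"
  proof (rule lipschitz_onI)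
    fix x y assume "x \<in> V" "y \<in> V"
    then show "dist (N x) (N y) \<le> C * dist x y"
      using le[of x y] le[of y x] by (auto simp: dist_real_def abs_le_iff dist_commute)
  qed (use C in simp)
  then show ?thesis by (rule lipschitz_on_continuous_on)
qed

text \<open>The reciprocal of the minimum of \<open>N\<close> over the compact Euclidean unit sphere of \<open>V\<close> works.\<close>
lemma norm_le_norm_on:
  fixes V :: "'a::euclidean_space set"
  assumes N: "norm_on V N" and V: "subspace V"
  obtains C where "0 < C" "\<And>x. x \<in> V \<Longrightarrow> norm x \<le> C * N x"
proof (cases "V \<inter> sphere 0 1 = {}")
  case True
  have "x = 0" if "x \<in> V" for x
  proof (rule ccontr)
    assume "x \<noteq> 0"
    then have "inverse (norm x) *\<^sub>R x \<in> V \<inter> sphere 0 1" using that V by (simp add: subspace_scale)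
    with True show False by blast
  qed
  then show thesis using norm_on_nonneg[OF N] by (intro that[of 1]) fastforce+
next
  case False
  have "compact (V \<inter> sphere 0 1)" using V by (simp add: closed_Int_compact closed_subspace)
  from continuous_attains_inf[OF this False continuous_on_subset[OF continuous_on_norm_on[OF N V]]]
  obtain u where u: "u \<in> V" "norm u = 1" and min: "\<And>z. z \<in> V \<Longrightarrow> norm z = 1 \<Longrightarrow> N u \<le> N z"
    by auto
  have pos: "0 < N u" using norm_on_pos[OF N u(1)] u(2) by force
  have "norm x \<le> inverse (N u) * N x" if x: "x \<in> V" for x
  proof (cases "x = 0")
    case True then show ?thesis using pos norm_on_nonneg[OF N x] by simp
  next
    case False
    then have "N u \<le> N (inverse (norm x) *\<^sub>R x)" using x V by (intro min) (simp_all add: subspace_scale)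
    then show ?thesis using False pos by (simp add: norm_on_scale[OF N x] field_simps)
  qed
  with pos show thesis by (intro that[of "inverse (N u)"]) auto
qed

lemma sym_convex_body_unit_ball:
  fixes V :: "'a::euclidean_space set"
  assumes N: "norm_on V N" and V: "subspace V"
  shows "sym_convex_body V (unit_ball V N)"
proof -
  have cont: "continuous_on V N" by (rule continuous_on_norm_on[OF N V])
  obtain C where C: "0 < C" "\<And>x. x \<in> V \<Longrightarrow> norm x \<le> C * N x"
    using norm_le_norm_on[OF N V] by blast
  have "closed (unit_ball V N)"
  proof -
    have "unit_ball V N = V \<inter> N -` {..1}" by (auto simp: unit_ball_def)
    then show ?thesis using continuous_closed_preimage[OF cont closed_subspace[OF V]] by simp
  qed
  moreover have "bounded (unit_ball V N)"
  proof (rule boundedI)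
    fix x assume "x \<in> unit_ball V N"
    then have "norm x \<le> C * N x" "N x \<le> 1" using C by (auto simp: unit_ball_def)
    then show "norm x \<le> C" using C(1) by (meson mult_left_le less_imp_le order_trans)
  qed
  ultimately have "compact (unit_ball V N)" by (simp add: compact_eq_bounded_closed)
  moreover have "convex (unit_ball V N)"
  proof (rule convexI)
    fix x y and u v :: real
    assume xy: "x \<in> unit_ball V N" "y \<in> unit_ball V N" and uv: "0 \<le> u" "0 \<le> v" "u + v = 1"
    have mem: "u *\<^sub>R x \<in> V" "v *\<^sub>R y \<in> V" using xy V by (auto simp: unit_ball_def subspace_scale)
    have "N (u *\<^sub>R x + v *\<^sub>R y) \<le> u * N x + v * N y"
      using norm_on_triangle[OF N mem] xy uv by (simp add: norm_on_scale[OF N] unit_ball_def)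
    also have "\<dots> \<le> u * 1 + v * 1"
      using xy uv by (intro add_mono mult_left_mono) (auto simp: unit_ball_def)
    finally show "u *\<^sub>R x + v *\<^sub>R y \<in> unit_ball V N"
      using mem uv V by (simp add: unit_ball_def subspace_add)
  qed
  moreover have "(top_of_set V) interior_of (unit_ball V N) \<noteq> {}"
  proof -
    have "openin (top_of_set V) (V \<inter> N -` {..<1})"
      using continuous_openin_preimage_gen[OF cont] by simp
    moreover have "V \<inter> N -` {..<1} \<subseteq> unit_ball V N" by (auto simp: unit_ball_def)
    moreover have "0 \<in> V \<inter> N -` {..<1}"
      using norm_on_eq_0_iff[OF N subspace_0[OF V]] subspace_0[OF V] by simp
    ultimately show ?thesis using interior_of_maximal by blast
  qed
  moreover have "unit_ball V N = uminus ` unit_ball V N"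
  proof -
    have neg: "- x \<in> unit_ball V N" if "x \<in> unit_ball V N" for x
      using that V norm_on_scale[OF N, of x "-1"] by (auto simp: unit_ball_def subspace_neg)
    then have "x \<in> uminus ` unit_ball V N" if "x \<in> unit_ball V N" for x
      using that by (intro image_eqI[of _ _ "- x"]) auto
    with neg show ?thesis by blast
  qed
  ultimately show ?thesis by (auto simp: sym_convex_body_def unit_ball_def)
qed

lemma minkowski_functional_unit_ball:
  assumes N: "norm_on V N" and V: "subspace V" and x: "x \<in> V"
  shows "minkowski_functional (unit_ball V N) x = N x"
proof -
  have "{r. 0 < r \<and> inverse r *\<^sub>R x \<in> unit_ball V N} = {r. 0 < r \<and> N x \<le> r}"
    using x V by (auto simp: unit_ball_def norm_on_scale[OF N x] subspace_scale field_simps)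
  also have "\<dots> = (if N x = 0 then {0<..} else {N x..})"
    using norm_on_nonneg[OF N x] by auto
  finally show ?thesis by (simp add: minkowski_functional_def)
qed

text \<open>
  If \<open>p\<close> is an interior point, then so is \<open>- p\<close>, and averaging neighbourhoods of the two gives a
  neighbourhood of their midpoint 0.
\<close>
lemma sym_convex_body_contains_ball:
  fixes V :: "'a::euclidean_space set"
  assumes P: "sym_convex_body V P" and V: "subspace V"
  obtains e where "0 < e" "V \<inter> ball 0 e \<subseteq> P"
proof -
  obtain p where "p \<in> (top_of_set V) interior_of P" using P by (auto simp: sym_convex_body_def)
  then obtain U where U: "openin (top_of_set V) U" "p \<in> U" "U \<subseteq> P"
    by (auto simp: interior_of_def)
  then obtain e where e: "0 < e" "ball p e \<inter> V \<subseteq> U" and pV: "p \<in> V"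
    by (meson openin_contains_ball openin_imp_subset subsetD)
  have neg: "- x \<in> P" if "x \<in> P" for x using P that unfolding sym_convex_body_def by blast
  have "v \<in> P" if v: "v \<in> V" "norm v < e" for v
  proof -
    have "p + v \<in> P" "p - v \<in> P"
      using e U(3) v pV V by (auto simp: dist_norm subspace_add subspace_diff subset_iff)
    then have "(1/2) *\<^sub>R (p + v) + (1/2) *\<^sub>R (- (p - v)) \<in> P"
      using P neg[of "p - v"] unfolding sym_convex_body_def by (intro convexD) auto
    moreover have "(1/2) *\<^sub>R (p + v) + (1/2) *\<^sub>R (- (p - v)) = v"
      by (simp add: algebra_simps flip: scaleR_add_left)
    ultimately show ?thesis by simp
  qed
  with e(1) show thesis by (intro that[of e]) auto
qed

text \<open>
  The infimum is attained: since \<open>P\<close> is star-shaped about 0, every \<open>s > r\<close> is admissible, and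
  closedness of \<open>P\<close> allows \<open>s\<close> to decrease to \<open>r\<close>.
\<close>
lemma minkowski_functional_le_iff:
  fixes V :: "'a::euclidean_space set"
  assumes P: "sym_convex_body V P" and V: "subspace V" and x: "x \<in> V" and r: "0 < r"
  shows "minkowski_functional P x \<le> r \<longleftrightarrow> inverse r *\<^sub>R x \<in> P"
proof
  let ?S = "{r. 0 < r \<and> inverse r *\<^sub>R x \<in> P}"
  have bdd: "bdd_below ?S" by (rule bdd_belowI[of _ 0]) auto
  show "minkowski_functional P x \<le> r" if "inverse r *\<^sub>R x \<in> P"
    unfolding minkowski_functional_def using that r by (intro cInf_lower[OF _ bdd]) auto
  assume le: "minkowski_functional P x \<le> r"
  obtain e where e: "0 < e" "V \<inter> ball 0 e \<subseteq> P" using sym_convex_body_contains_ball[OF P V] by blast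
  have zero: "0 \<in> P" using e V by (auto simp: subspace_0 subset_iff)
  have "norm ((e / (2 * norm x + 2)) *\<^sub>R x) < e"
    using e(1) by (simp add: divide_less_eq add_nonneg_pos)
  then have "(e / (2 * norm x + 2)) *\<^sub>R x \<in> V \<inter> ball 0 e"
    using x V by (simp add: subspace_scale)
  then have ne: "?S \<noteq> {}"
    using e by (auto intro!: exI[of _ "inverse (e / (2 * norm x + 2))"] simp: add_nonneg_pos)
  have mem: "inverse s *\<^sub>R x \<in> P" if s: "r < s" for s
  proof -
    obtain q where q: "0 < q" "inverse q *\<^sub>R x \<in> P" "q < s"
      using cInf_lessD[OF ne, of s] le s by (auto simp: minkowski_functional_def)
    have "(q / s) *\<^sub>R (inverse q *\<^sub>R x) + (1 - q / s) *\<^sub>R 0 \<in> P"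
      using q r s zero P by (intro convexD) (auto simp: sym_convex_body_def)
    then show ?thesis using q by (simp add: field_simps)
  qed
  have closed: "closed P" using P by (simp add: sym_convex_body_def compact_imp_closed)
  have lim: "(\<lambda>n. inverse (r + inverse (real (Suc n))) *\<^sub>R x) \<longlonglongrightarrow> inverse (r + 0) *\<^sub>R x"
    using r by (intro tendsto_intros LIMSEQ_inverse_real_of_nat) auto
  have "inverse (r + inverse (real (Suc n))) *\<^sub>R x \<in> P" for n by (rule mem) simp
  from closed_sequentially[OF closed this lim] show "inverse r *\<^sub>R x \<in> P" by simp
qed

lemma norm_on_minkowski_functional:
  fixes V :: "'a::euclidean_space set"
  assumes P: "sym_convex_body V P" and V: "subspace V"
  shows "norm_on V (minkowski_functional P)"
proof -
  let ?g = "minkowski_functional P"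
  note iff = minkowski_functional_le_iff[OF P V]
  obtain e where e: "0 < e" "V \<inter> ball 0 e \<subseteq> P" using sym_convex_body_contains_ball[OF P V] by blast
  have zero: "0 \<in> P" using e V by (auto simp: subspace_0 subset_iff)
  have neg: "- x \<in> P \<longleftrightarrow> x \<in> P" for x
    using P unfolding sym_convex_body_def by (metis imageI minus_minus)
  have "bounded P" using P by (simp add: sym_convex_body_def compact_imp_bounded)
  then obtain b where b: "\<And>x. x \<in> P \<Longrightarrow> norm x \<le> b" "0 < b"
    unfolding bounded_pos by blast
  \<comment> \<open>boundedness of \<open>P\<close> bounds the functional from below, which makes it definite\<close>
  have lower: "norm x \<le> b * r" if "x \<in> V" "0 < r" "?g x \<le> r" for x r
    using b(1)[of "inverse r *\<^sub>R x"] iff[of x r] that by (simp add: field_simps)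
  have nonneg: "0 \<le> ?g x" if x: "x \<in> V" for x
  proof (rule ccontr)
    assume neg: "\<not> 0 \<le> ?g x"
    have "x = 0"
    proof (rule ccontr)
      assume "x \<noteq> 0"
      have "?g x \<le> norm x / (2 * b)" using neg b(2) by (simp add: order.trans[of _ 0])
      then show False using lower[OF x, of "norm x / (2 * b)"] b(2) \<open>x \<noteq> 0\<close> by simp
    qed
    then have "{r. 0 < r \<and> inverse r *\<^sub>R x \<in> P} = {0<..}" using zero by auto
    then show False using neg by (simp add: minkowski_functional_def)
  qed
  have zero_iff: "?g x = 0 \<longleftrightarrow> x = 0" if x: "x \<in> V" for x
  proof
    assume g: "?g x = 0"
    have "norm x \<le> 0 + c" if "0 < c" for c using lower[OF x, of "c / b"] g that b(2) by simp
    then show "x = 0" using field_le_epsilon[of "norm x" 0] by simp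
  next
    assume "x = 0"
    then have "{r. 0 < r \<and> inverse r *\<^sub>R x \<in> P} = {0<..}" using zero by auto
    then show "?g x = 0" by (simp add: minkowski_functional_def)
  qed
  have scale_le: "?g (c *\<^sub>R x) \<le> \<bar>c\<bar> * ?g x" if x: "x \<in> V" and c: "c \<noteq> 0" for x c
  proof (rule field_le_epsilon)
    fix d :: real assume d: "0 < d"
    \<comment> \<open>the slack makes \<open>r\<close> positive even if \<open>?g x = 0\<close>, and \<open>\<bar>c\<bar> * r\<close> exceeds the target by \<open>d\<close>\<close>
    define r where "r = ?g x + d / \<bar>c\<bar>"
    have r: "0 < r" using nonneg[OF x] d c by (simp add: r_def add_nonneg_pos)
    have "inverse r *\<^sub>R x \<in> P" using iff[OF x r] d c by (simp add: r_def)
    then have "sgn c *\<^sub>R (inverse r *\<^sub>R x) \<in> P"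
      using c neg[of "inverse r *\<^sub>R x"] by (cases "0 < c") simp_all
    moreover have "inverse (\<bar>c\<bar> * r) *\<^sub>R (c *\<^sub>R x) = sgn c *\<^sub>R (inverse r *\<^sub>R x)"
      using c by (auto simp: sgn_if field_simps)
    ultimately have "inverse (\<bar>c\<bar> * r) *\<^sub>R (c *\<^sub>R x) \<in> P" by metis
    then have "?g (c *\<^sub>R x) \<le> \<bar>c\<bar> * r"
      using iff[of "c *\<^sub>R x" "\<bar>c\<bar> * r"] x V c r by (simp add: subspace_scale)
    then show "?g (c *\<^sub>R x) \<le> \<bar>c\<bar> * ?g x + d" using c by (simp add: r_def distrib_left)
  qed
  have scale: "?g (c *\<^sub>R x) = \<bar>c\<bar> * ?g x" if x: "x \<in> V" for x c
  proof (cases "c = 0")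
    case True
    then show ?thesis using zero_iff[OF subspace_0[OF V]] by simp
  next
    case False
    have "?g x \<le> \<bar>inverse c\<bar> * ?g (c *\<^sub>R x)"
      using scale_le[of "c *\<^sub>R x" "inverse c"] False x V by (simp add: subspace_scale)
    then have "\<bar>c\<bar> * ?g x \<le> ?g (c *\<^sub>R x)" using False by (simp add: field_simps)
    with scale_le[OF x False] show ?thesis by simp
  qed
  have triangle: "?g (x + y) \<le> ?g x + ?g y" if x: "x \<in> V" and y: "y \<in> V" for x y
  proof (rule field_le_epsilon)
    fix d :: real assume d: "0 < d"
    define r s where "r = ?g x + d / 2" and "s = ?g y + d / 2"
    have pos: "0 < r" "0 < s" using nonneg[OF x] nonneg[OF y] d by (auto simp: r_def s_def)
    have "inverse r *\<^sub>R x \<in> P" "inverse s *\<^sub>R y \<in> P"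
      using iff[OF x pos(1)] iff[OF y pos(2)] d by (auto simp: r_def s_def)
    \<comment> \<open>the normalised sum is a convex combination of the normalised summands\<close>
    then have "(r / (r + s)) *\<^sub>R (inverse r *\<^sub>R x) + (s / (r + s)) *\<^sub>R (inverse s *\<^sub>R y) \<in> P"
      using P pos by (intro convexD) (auto simp: sym_convex_body_def simp flip: add_divide_distrib)
    moreover have "r / (r + s) * inverse r = inverse (r + s)" "s / (r + s) * inverse s = inverse (r + s)"
      using pos by (simp_all add: divide_inverse)
    then have "(r / (r + s)) *\<^sub>R (inverse r *\<^sub>R x) + (s / (r + s)) *\<^sub>R (inverse s *\<^sub>R y)
        = inverse (r + s) *\<^sub>R (x + y)"
      by (simp only: scaleR_scaleR scaleR_add_right)
    ultimately have "?g (x + y) \<le> r + s"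
      using iff[of "x + y" "r + s"] x y V pos by (simp add: subspace_add)
    then show "?g (x + y) \<le> ?g x + ?g y + d" by (simp add: r_def s_def)
  qed
  show ?thesis unfolding norm_on_def using nonneg zero_iff scale triangle by blast
qed

lemma unit_ball_minkowski_functional:
  fixes V :: "'a::euclidean_space set"
  assumes P: "sym_convex_body V P" and V: "subspace V"
  shows "unit_ball V (minkowski_functional P) = P"
  using minkowski_functional_le_iff[OF P V, of _ 1] P
  by (auto simp: unit_ball_def sym_convex_body_def)

lemma mem_iff_minkowski_functional:
  fixes V :: "'a::euclidean_space set"
  assumes "sym_convex_body V P" "subspace V" "x \<in> V"
  shows "x \<in> P \<longleftrightarrow> minkowski_functional P x \<le> 1"
  using minkowski_functional_le_iff[OF assms, of 1] by simp

lemma frontier_of_sym_convex_body: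
  fixes V :: "'a::euclidean_space set"
  assumes P: "sym_convex_body V P" and V: "subspace V"
  shows "(top_of_set V) frontier_of P = {x \<in> V. minkowski_functional P x = 1}"
proof -
  let ?g = "minkowski_functional P"
  note N = norm_on_minkowski_functional[OF P V]
  have PV: "P \<subseteq> V" "closed P" using P by (auto simp: sym_convex_body_def compact_imp_closed)
  have "closedin (top_of_set V) P" using PV by (simp add: closed_subset)
  then have cl: "(top_of_set V) closure_of P = P" by (simp add: closure_of_closedin)
  have "(top_of_set V) interior_of P = {x \<in> V. ?g x < 1}"
  proof
    have "openin (top_of_set V) (V \<inter> ?g -` {..<1})"
      using continuous_openin_preimage_gen[OF continuous_on_norm_on[OF N V]] by simp
    moreover have "V \<inter> ?g -` {..<1} \<subseteq> P" using mem_iff_minkowski_functional[OF P V] by auto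
    ultimately show "{x \<in> V. ?g x < 1} \<subseteq> (top_of_set V) interior_of P"
      using interior_of_maximal by (fastforce simp: vimage_def)
  next
    show "(top_of_set V) interior_of P \<subseteq> {x \<in> V. ?g x < 1}"
    proof
      fix x assume "x \<in> (top_of_set V) interior_of P"
      then obtain U where U: "openin (top_of_set V) U" "x \<in> U" "U \<subseteq> P"
        by (auto simp: interior_of_def)
      then obtain e where e: "0 < e" "ball x e \<inter> V \<subseteq> U" and xV: "x \<in> V"
        by (meson openin_contains_ball openin_imp_subset subsetD)
      \<comment> \<open>an interior point can be stretched slightly without leaving the body\<close>
      define d where "d = e / (2 * norm x + 2)"
      have d: "0 < d" "norm (d *\<^sub>R x) < e"
        using e(1) by (auto simp: d_def field_simps add_pos_nonneg add_nonneg_pos)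
      have "(1 + d) *\<^sub>R x \<in> P"
        using d e(2) U(3) xV V
        by (auto simp: subset_iff dist_norm algebra_simps subspace_add subspace_scale)
      then have "(1 + d) * ?g x \<le> 1"
        using mem_iff_minkowski_functional[OF P V, of "(1 + d) *\<^sub>R x"] xV V d
        by (simp add: subspace_scale norm_on_scale[OF N xV])
      then have "?g x < 1"
        using mult_pos_pos[OF d(1), of "?g x"] by (cases "0 < ?g x") (simp_all add: distrib_right)
      with xV show "x \<in> {x \<in> V. ?g x < 1}" by simp
    qed
  qed
  then show ?thesis
    using cl PV mem_iff_minkowski_functional[OF P V]
    by (auto simp: frontier_of_def subset_iff not_less intro: antisym)
qed


section \<open>Polars and norming functionals\<close>

lemma mem_polar_iff: "y \<in> polar V C \<longleftrightarrow> y \<in> V \<and> (\<forall>x\<in>C. \<bar>x \<bullet> y\<bar> \<le> 1)"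
  by (auto simp: polar_def SUP_le_iff)

lemma mem_polar_unit_ball_iff:
  assumes N: "norm_on V N" and V: "subspace V"
  shows "y \<in> polar V (unit_ball V N) \<longleftrightarrow> y \<in> V \<and> (\<forall>x\<in>V. \<bar>x \<bullet> y\<bar> \<le> N x)"
proof
  assume y: "y \<in> polar V (unit_ball V N)"
  have "\<bar>x \<bullet> y\<bar> \<le> 1 * N x" if "x \<in> V" for x
    by (rule bounded_on_unit_ball_imp[OF N V that, where f = "\<lambda>x. x \<bullet> y"])
      (use y in \<open>auto simp: mem_polar_iff\<close>)
  with y show "y \<in> V \<and> (\<forall>x\<in>V. \<bar>x \<bullet> y\<bar> \<le> N x)" by (simp add: mem_polar_iff)
qed (force simp: mem_polar_iff unit_ball_def)

text \<open>
  A separating hyperplane in the ambient space need not have its normal in \<open>V\<close>; its orthogonal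
  projection to \<open>V\<close> takes the same values on \<open>V\<close>.  Symmetry of \<open>P\<close> turns the one-sided bound into
  membership in the polar after normalisation.
\<close>
lemma separate_from_sym_convex_body:
  fixes V :: "'a::euclidean_space set"
  assumes P: "sym_convex_body V P" and V: "subspace V" and x: "x \<in> V" "x \<notin> P"
  obtains y where "y \<in> polar V P" "1 < x \<bullet> y"
proof -
  have P': "convex P" "closed P" "P \<subseteq> V" using P by (auto simp: sym_convex_body_def compact_imp_closed)
  have neg: "- z \<in> P" if "z \<in> P" for z using P that unfolding sym_convex_body_def by blast
  obtain e where e: "0 < e" "V \<inter> ball 0 e \<subseteq> P" using sym_convex_body_contains_ball[OF P V] by blast
  have zero: "0 \<in> P" using e V by (auto simp: subspace_0 subset_iff)
  obtain a b where ab: "a \<bullet> x < b" "\<And>z. z \<in> P \<Longrightarrow> b < a \<bullet> z"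
    using separating_hyperplane_closed_point[OF P'(1,2) x(2)] by blast
  \<comment> \<open>the level \<open>b\<close> is negative, so dividing by it also reverses the inequality at \<open>x\<close>\<close>
  have b: "b < 0" using ab(2)[OF zero] by simp
  obtain w n where w: "w \<in> V" "\<And>z. z \<in> V \<Longrightarrow> orthogonal n z" "a = w + n"
    using orthogonal_subspace_decomp_exists[of V a] V by (metis span_eq_iff)
  have aw: "a \<bullet> z = w \<bullet> z" if "z \<in> V" for z
    using w that by (simp add: inner_add_left orthogonal_def)
  have "inverse b *\<^sub>R w \<in> polar V P"
  proof -
    have "\<bar>z \<bullet> (inverse b *\<^sub>R w)\<bar> \<le> 1" if z: "z \<in> P" for z
    proof -
      have "b < w \<bullet> z" "b < - (w \<bullet> z)" using ab(2)[OF z] ab(2)[OF neg[OF z]] aw z P'(3) by auto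
      then have "\<bar>w \<bullet> z\<bar> \<le> \<bar>b\<bar>" by linarith
      then show ?thesis using b by (simp add: inner_commute abs_mult field_simps)
    qed
    then show ?thesis using w(1) V by (simp add: mem_polar_iff subspace_scale)
  qed
  moreover have "1 < x \<bullet> (inverse b *\<^sub>R w)"
    using ab(1) b aw[OF x(1)] by (simp add: inner_commute field_simps)
  ultimately show thesis by (rule that)
qed

text \<open>
  \<open>P\<close> contains all vectors of \<open>V\<close> shorter than some \<open>e > 0\<close>.  Testing \<open>y\<close> against its own multiple of
  length \<open>e / 2\<close> bounds \<open>y\<close>.
\<close>
lemma compact_polar:
  fixes V :: "'a::euclidean_space set"
  assumes P: "sym_convex_body V P" and V: "subspace V"
  shows "compact (polar V P)"
proof -
  obtain e where e: "0 < e" "V \<inter> ball 0 e \<subseteq> P" using sym_convex_body_contains_ball[OF P V] by blast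
  have "closed (V \<inter> (\<Inter>x\<in>P. {y. \<bar>x \<bullet> y\<bar> \<le> 1}))"
    using V by (intro closed_Int closed_INT closed_subspace ballI closed_Collect_le continuous_intros)
  moreover have "polar V P = V \<inter> (\<Inter>x\<in>P. {y. \<bar>x \<bullet> y\<bar> \<le> 1})" by (auto simp: mem_polar_iff)
  moreover have "norm y \<le> 2 / e" if y: "y \<in> polar V P" for y
  proof (cases "y = 0")
    case False
    have "(e / (2 * norm y)) *\<^sub>R y \<in> V \<inter> ball 0 e"
      using y V e(1) False by (simp add: mem_polar_iff subspace_scale)
    then have "\<bar>((e / (2 * norm y)) *\<^sub>R y) \<bullet> y\<bar> \<le> 1" using y e(2) unfolding mem_polar_iff by blast
    then show ?thesis using e(1) False
      by (simp add: field_simps flip: power2_norm_eq_inner) (simp add: power2_eq_square)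
  qed (use e in simp)
  ultimately show ?thesis by (metis compact_eq_bounded_closed boundedI)
qed

text \<open>
  This finite-dimensional form of the Hahn-Banach theorem makes crossnorms multiplicative.  By
  compactness some \<open>y\<close> in the polar maximises \<open>x \<bullet> y\<close>.  If the maximum were below a number \<open>m < N x\<close>,
  then \<open>x / m\<close> would lie outside the unit ball, and separating it would produce a larger value.
\<close>
lemma norming_functional:
  fixes V :: "'a::euclidean_space set"
  assumes N: "norm_on V N" and V: "subspace V" and x: "x \<in> V"
  obtains y where "y \<in> polar V (unit_ball V N)" "x \<bullet> y = N x"
proof -
  let ?P = "polar V (unit_ball V N)"
  note body = sym_convex_body_unit_ball[OF N V]
  have "0 \<in> ?P" using V by (simp add: mem_polar_iff subspace_0)
  then have "?P \<noteq> {}" by blast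
  moreover have "continuous_on ?P (\<lambda>y. x \<bullet> y)" by (intro continuous_intros)
  ultimately
  obtain y where y: "y \<in> ?P" and max: "\<And>z. z \<in> ?P \<Longrightarrow> x \<bullet> z \<le> x \<bullet> y"
    using continuous_attains_sup[OF compact_polar[OF body V]] by metis
  have le: "x \<bullet> y \<le> N x" using y x by (force simp: mem_polar_unit_ball_iff[OF N V])
  have "\<not> x \<bullet> y < N x"
  proof
    assume "x \<bullet> y < N x"
    then obtain m where m: "x \<bullet> y < m" "m < N x" using dense by blast
    have m0: "0 < m" using max[OF \<open>0 \<in> ?P\<close>] m(1) by simp
    have "inverse m *\<^sub>R x \<in> V" "inverse m *\<^sub>R x \<notin> unit_ball V N"
      using x V m m0 by (simp_all add: unit_ball_def subspace_scale norm_on_scale[OF N x] field_simps)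
    then obtain z where "z \<in> ?P" "1 < (inverse m *\<^sub>R x) \<bullet> z"
      using separate_from_sym_convex_body[OF body V] by blast
    with max[of z] m m0 show False by (simp add: field_simps)
  qed
  with y le show thesis by (intro that[of y]) auto
qed


section \<open>Dual norms\<close>

text \<open>The supremum in \<^const>\<open>dual_norm\<close> is a real one and says nothing until it is known to be finite.\<close>
lemma in_dual_bdd_above:
  assumes N: "norm_on V N" and f: "in_dual V N f"
  shows "bdd_above ((\<lambda>x. \<bar>f x\<bar>) ` {x \<in> V. N x \<le> 1})"
proof -
  obtain C where C: "\<And>x. x \<in> V \<Longrightarrow> \<bar>f x\<bar> \<le> C * N x" using f unfolding in_dual_def by blast
  have "\<bar>f x\<bar> \<le> \<bar>C\<bar>" if "x \<in> V" "N x \<le> 1" for x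
  proof -
    have "C * N x \<le> \<bar>C\<bar> * 1" using that norm_on_nonneg[OF N] by (intro mult_mono) auto
    then show ?thesis using C[OF that(1)] by simp
  qed
  then show ?thesis by (intro bdd_aboveI2) auto
qed

lemma abs_le_dual_norm:
  assumes N: "norm_on V N" and V: "subspace V" and f: "in_dual V N f" and x: "x \<in> V"
  shows "\<bar>f x\<bar> \<le> dual_norm V N f * N x"
proof (rule bounded_on_unit_ball_imp[OF N V x])
  show "\<bar>f z\<bar> \<le> dual_norm V N f" if "z \<in> unit_ball V N" for z
    unfolding dual_norm_def using that by (intro cSUP_upper in_dual_bdd_above[OF N f]) (simp add: unit_ball_def)
qed (use f in \<open>simp add: in_dual_def\<close>)

lemma dual_norm_leI:
  assumes N: "norm_on V N" and V: "subspace V" and "\<And>x. x \<in> V \<Longrightarrow> \<bar>f x\<bar> \<le> c * N x" and c: "0 \<le> c"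
  shows "dual_norm V N f \<le> c"
proof -
  have "0 \<in> {x \<in> V. N x \<le> 1}" using norm_on_eq_0_iff[OF N subspace_0[OF V]] V by (simp add: subspace_0)
  then show ?thesis unfolding dual_norm_def
    using assms(3) c by (intro cSUP_least) (auto intro: order_trans mult_left_le)
qed

lemma dual_norm_nonneg:
  assumes N: "norm_on V N" and V: "subspace V" and f: "in_dual V N f"
  shows "0 \<le> dual_norm V N f"
proof -
  have "0 \<in> {x \<in> V. N x \<le> 1}" using norm_on_eq_0_iff[OF N subspace_0[OF V]] V by (simp add: subspace_0)
  from cSUP_upper[OF this in_dual_bdd_above[OF N f]] show ?thesis
    unfolding dual_norm_def by linarith
qed

lemma in_dual_inner:
  assumes "\<And>x. x \<in> V \<Longrightarrow> \<bar>x \<bullet> y\<bar> \<le> c * N x"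
  shows "in_dual V N (\<lambda>x. x \<bullet> y)"
  using assms by (auto simp: in_dual_def inner_add_left)

lemma subspace_coord_space: "subspace (coord_space S)"
  by (auto simp: subspace_def coord_space_def)

lemma subspace_tensor_space: "subspace (tensor_space D)"
  by (simp add: tensor_space_def subspace_coord_space)

text \<open>
  The vector representing \<open>f\<close> on the coordinate space.  Coordinates outside \<open>S\<close> are set to 0 because
  \<open>f\<close> is arbitrary there.
\<close>
definition riesz_vec :: "'n::finite set \<Rightarrow> (real ^ 'n \<Rightarrow> real) \<Rightarrow> real ^ 'n" where
  "riesz_vec S f = (\<chi> j. if j \<in> S then f (axis j 1) else 0)"

lemma riesz_vec_in_coord_space: "riesz_vec S f \<in> coord_space S"
  by (simp add: riesz_vec_def coord_space_def)

lemma inner_riesz_vec: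
  fixes x :: "real ^ 'n::finite"
  assumes f: "in_dual (coord_space S) N f" and x: "x \<in> coord_space S"
  shows "x \<bullet> riesz_vec S f = f x"
proof -
  have ax: "axis j 1 \<in> coord_space S" if "j \<in> S" for j
    using that by (auto simp: coord_space_def axis_def)
  have zero: "x $ j = 0" if "j \<notin> S" for j using x that by (simp add: coord_space_def)
  have "x = (\<Sum>j\<in>UNIV. x $ j *\<^sub>R axis j 1)"
    by (simp add: vec_eq_iff axis_def if_distrib cong: if_cong)
  also have "\<dots> = (\<Sum>j\<in>S. x $ j *\<^sub>R axis j 1)"
    by (rule sum.mono_neutral_right) (auto simp: zero)
  finally have "f x = f (\<Sum>j\<in>S. x $ j *\<^sub>R axis j 1)" by simp
  also have "\<dots> = (\<Sum>j\<in>S. f (x $ j *\<^sub>R axis j 1))"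
    by (rule in_dual_sum[OF f subspace_coord_space])
      (auto intro: subspace_scale[OF subspace_coord_space] ax)
  also have "\<dots> = (\<Sum>j\<in>S. x $ j * f (axis j 1))"
    using f ax by (intro sum.cong) (auto simp: in_dual_def)
  also have "\<dots> = x \<bullet> riesz_vec S f"
    unfolding inner_vec_def by (rule sum.mono_neutral_cong_left) (auto simp: zero riesz_vec_def)
  finally show ?thesis by simp
qed

text \<open>
  Only the coordinates of \<open>y\<close> inside the index sets matter, because \<open>t\<close> vanishes at every
  multi-index that leaves them.
\<close>
lemma tensor_functional_eq_inner:
  fixes D :: "'l::finite \<Rightarrow> 'n::finite set"
  assumes t: "t \<in> tensor_space D" and y: "\<And>i j. j \<in> D i \<Longrightarrow> y i $ j = f i (axis j 1)"
  shows "tensor_functional f t = t \<bullet> tensor_vec y"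
proof -
  have "t $ k * (\<Prod>i\<in>UNIV. f i (axis (k i) 1)) = t $ k * (\<Prod>i\<in>UNIV. y i $ k i)" for k
  proof (cases "\<forall>i. k i \<in> D i")
    case True then show ?thesis using y by simp
  next
    case False
    then have "t $ k = 0" using t by (simp add: tensor_space_def coord_space_def)
    then show ?thesis by simp
  qed
  then have "tensor_functional f t = (\<Sum>k\<in>UNIV. t $ k * (\<Prod>i\<in>UNIV. y i $ k i))"
    unfolding tensor_functional_def by (rule sum.cong[OF refl])
  then show ?thesis by (simp add: inner_vec_def tensor_vec_def)
qed


section \<open>Decomposable vectors\<close>

lemma tensor_vec_scale:
  "tensor_vec (\<lambda>i. c i *\<^sub>R x i) = (\<Prod>i\<in>UNIV. c i) *\<^sub>R tensor_vec x"
  by (simp add: tensor_vec_def vec_eq_iff prod.distrib)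

lemma tensor_vec_eq_0_iff: "tensor_vec x = 0 \<longleftrightarrow> (\<exists>i. x i = 0)"
proof -
  have "tensor_vec x = 0 \<longleftrightarrow> tensor_vec x \<bullet> tensor_vec x = 0" by simp
  also have "\<dots> \<longleftrightarrow> (\<exists>i. x i = 0)" by (simp add: inner_tensor_vec del: inner_eq_zero_iff) simp
  finally show ?thesis .
qed

lemma tensor_vec_upd:
  fixes a :: "'l::finite \<Rightarrow> real ^ 'n::finite"
  shows "tensor_vec (a(i := x)) = (\<chi> k. x $ k i * (\<Prod>j\<in>UNIV - {i}. a j $ k j))"
proof -
  have "(\<Prod>j\<in>UNIV. (a(i := x)) j $ k j) = x $ k i * (\<Prod>j\<in>UNIV - {i}. (a(i := x)) j $ k j)" for k
    by (subst prod.remove[of UNIV i]) simp_all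
  moreover have "(\<Prod>j\<in>UNIV - {i}. (a(i := x)) j $ k j) = (\<Prod>j\<in>UNIV - {i}. a j $ k j)" for k
    by (intro prod.cong) auto
  ultimately show ?thesis by (simp add: tensor_vec_def vec_eq_iff)
qed

lemma tensor_vec_upd_add:
  "tensor_vec (a(i := x + y)) = tensor_vec (a(i := x)) + tensor_vec (a(i := y))"
  by (simp add: tensor_vec_upd vec_eq_iff distrib_right)

lemma tensor_vec_upd_scale:
  "tensor_vec (a(i := c *\<^sub>R x)) = c *\<^sub>R tensor_vec (a(i := x))"
  by (simp add: tensor_vec_upd vec_eq_iff)

lemma proj_tensor_subset_iff:
  assumes "convex Q"
  shows "proj_tensor P \<subseteq> Q \<longleftrightarrow> (\<forall>x. (\<forall>i. x i \<in> P i) \<longrightarrow> tensor_vec x \<in> Q)"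
proof -
  have "proj_tensor P \<subseteq> Q \<longleftrightarrow> {tensor_vec x |x. \<forall>i. x i \<in> P i} \<subseteq> Q"
    unfolding proj_tensor_def using assms by (meson hull_minimal hull_subset order_trans)
  then show ?thesis by blast
qed

text \<open>A bound \<open>\<bar>s \<bullet> t\<bar> \<le> 1\<close> on the generators \<open>s\<close> passes to their convex hull, since it cuts out a slab.\<close>
lemma mem_inj_tensor_iff:
  "t \<in> inj_tensor D P \<longleftrightarrow> t \<in> tensor_space D \<and>
     (\<forall>y. (\<forall>i. y i \<in> polar (coord_space (D i)) (P i)) \<longrightarrow> \<bar>t \<bullet> tensor_vec y\<bar> \<le> 1)"
proof -
  have eq: "{s. \<bar>s \<bullet> t\<bar> \<le> 1} = {s. t \<bullet> s \<le> 1} \<inter> {s. t \<bullet> s \<ge> - 1}"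
    by (auto simp: inner_commute)
  have "convex {s. \<bar>s \<bullet> t\<bar> \<le> 1}"
    unfolding eq by (intro convex_Int convex_halfspace_le convex_halfspace_ge)
  from proj_tensor_subset_iff[OF this, of "\<lambda>i. polar (coord_space (D i)) (P i)"] show ?thesis
    unfolding inj_tensor_def mem_polar_iff[of t] subset_iff Ball_def mem_Collect_eq inner_commute[of t]
    by (rule arg_cong)
qed

lemma inj_tensorD:
  assumes "t \<in> inj_tensor D P" "\<And>i. y i \<in> polar (coord_space (D i)) (P i)"
  shows "\<bar>t \<bullet> tensor_vec y\<bar> \<le> 1"
  using assms by (simp add: mem_inj_tensor_iff)


section \<open>Tensorial bodies and reasonable crossnorms\<close>

text \<open>
  Each inclusion matches one crossnorm axiom by rescaling: a family \<open>x\<^sub>i\<close> is divided by \<open>N\<^sub>i x\<^sub>i\<close> to land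
  in the unit balls, and a family of functionals by their dual norms to land in the polars.  The
  families in which some divisor is 0 have zero tensor product and are treated apart.
\<close>
lemma reasonable_crossnorm_iff_between:
  fixes D :: "'l::finite \<Rightarrow> 'n::finite set"
  assumes Q: "sym_convex_body (tensor_space D) Q"
    and N: "\<And>i. norm_on (coord_space (D i)) (N i)"
  shows "reasonable_crossnorm D N (minkowski_functional Q) \<longleftrightarrow>
    proj_tensor (\<lambda>i. unit_ball (coord_space (D i)) (N i)) \<subseteq> Q \<and>
    Q \<subseteq> inj_tensor D (\<lambda>i. unit_ball (coord_space (D i)) (N i))"
    (is "?cross \<longleftrightarrow> proj_tensor ?B \<subseteq> Q \<and> _")
proof
  let ?W = "tensor_space D" and ?V = "\<lambda>i. coord_space (D i)" and ?g = "minkowski_functional Q"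
  note W = subspace_tensor_space[of D] and V = subspace_coord_space
  note g = norm_on_minkowski_functional[OF Q W]
  have Q': "convex Q" "Q \<subseteq> ?W" using Q by (auto simp: sym_convex_body_def)
  note memQ = mem_iff_minkowski_functional[OF Q W]
  {
    assume cross: ?cross
    have "tensor_vec x \<in> Q" if x: "\<forall>i. x i \<in> ?B i" for x
    proof -
      have xV: "\<And>i. x i \<in> ?V i" using x by (simp add: unit_ball_def)
      have "?g (tensor_vec x) \<le> (\<Prod>i\<in>UNIV. N i (x i))"
        using cross xV by (simp add: reasonable_crossnorm_def)
      also have "\<dots> \<le> 1" using x norm_on_nonneg[OF N] by (intro prod_le_1) (auto simp: unit_ball_def)
      finally show ?thesis using memQ tensor_vec_in_tensor_space[of x D] xV by simp
    qed
    moreover have "\<bar>t \<bullet> tensor_vec y\<bar> \<le> 1"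
      if t: "t \<in> Q" and y: "\<forall>i. y i \<in> polar (?V i) (?B i)" for t y
    proof -
      let ?f = "\<lambda>i x. x \<bullet> y i"
      have tW: "t \<in> ?W" using t Q' by blast
      have bnd: "\<bar>x \<bullet> y i\<bar> \<le> 1 * N i x" if "x \<in> ?V i" for i x
        using y that mem_polar_unit_ball_iff[OF N V] by auto
      have dual: "in_dual (?V i) (N i) (?f i)" for i by (rule in_dual_inner[OF bnd])
      have le1: "dual_norm (?V i) (N i) (?f i) \<le> 1" for i
        by (rule dual_norm_leI[OF N V bnd]) auto
      have tf: "tensor_functional ?f t = t \<bullet> tensor_vec y"
        by (rule tensor_functional_eq_inner[OF tW]) (simp add: inner_axis')
      have "in_dual ?W ?g (tensor_functional ?f)"
        and le: "dual_norm ?W ?g (tensor_functional ?f) \<le> (\<Prod>i\<in>UNIV. dual_norm (?V i) (N i) (?f i))"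
        using cross dual by (simp_all add: reasonable_crossnorm_def)
      from abs_le_dual_norm[OF g W this(1) tW]
      have "\<bar>t \<bullet> tensor_vec y\<bar> \<le> dual_norm ?W ?g (tensor_functional ?f) * ?g t" by (simp add: tf)
      also have "\<dots> \<le> 1 * 1"
      proof (intro mult_mono)
        show "dual_norm ?W ?g (tensor_functional ?f) \<le> 1"
          using le le1 dual_norm_nonneg[OF N V dual] by (smt (verit) prod_le_1)
      qed (use t memQ[OF tW] norm_on_nonneg[OF g tW] in auto)
      finally show ?thesis by simp
    qed
    ultimately show "proj_tensor ?B \<subseteq> Q \<and> Q \<subseteq> inj_tensor D ?B"
      using Q' proj_tensor_subset_iff[OF Q'(1)] by (auto simp: mem_inj_tensor_iff)
  }
  assume between: "proj_tensor ?B \<subseteq> Q \<and> Q \<subseteq> inj_tensor D ?B"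
  have "?g (tensor_vec x) \<le> (\<Prod>i\<in>UNIV. N i (x i))" if x: "\<And>i. x i \<in> ?V i" for x
  proof (cases "\<exists>i. x i = 0")
    case True
    then have "tensor_vec x = 0" by (simp add: tensor_vec_eq_0_iff)
    then show ?thesis using norm_on_eq_0_iff[OF g subspace_0[OF W]] norm_on_nonneg[OF N x]
      by (simp add: prod_nonneg)
  next
    case False
    have pos: "0 < N i (x i)" for i using False by (intro norm_on_pos[OF N x]) auto
    define p where "p = (\<Prod>i\<in>UNIV. N i (x i))"
    have p: "0 < p" using pos by (simp add: p_def prod_pos)
    have "inverse (N i (x i)) *\<^sub>R x i \<in> ?B i" for i
      using x pos[of i] by (simp add: unit_ball_def norm_on_scale[OF N x] subspace_scale[OF V])
    then have "tensor_vec (\<lambda>i. inverse (N i (x i)) *\<^sub>R x i) \<in> Q"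
      using between proj_tensor_subset_iff[OF Q'(1), of ?B] by simp
    then have "inverse p *\<^sub>R tensor_vec x \<in> Q"
      by (simp add: tensor_vec_scale p_def flip: prod_inversef)
    then show ?thesis
      using minkowski_functional_le_iff[OF Q W tensor_vec_in_tensor_space[OF x] p] by (simp add: p_def)
  qed
  moreover have "in_dual ?W ?g (tensor_functional f) \<and>
      dual_norm ?W ?g (tensor_functional f) \<le> (\<Prod>i\<in>UNIV. dual_norm (?V i) (N i) (f i))"
    if f: "\<And>i. in_dual (?V i) (N i) (f i)" for f
  proof -
    define y where "y i = riesz_vec (D i) (f i)" for i
    define r where "r i = dual_norm (?V i) (N i) (f i)" for i
    have r0: "0 \<le> r i" for i unfolding r_def by (rule dual_norm_nonneg[OF N V f])
    have yV: "y i \<in> ?V i" for i by (simp add: y_def riesz_vec_in_coord_space)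
    have yb: "\<bar>x \<bullet> y i\<bar> \<le> r i * N i x" if "x \<in> ?V i" for i x
      using abs_le_dual_norm[OF N V f that] inner_riesz_vec[OF f that] by (simp add: r_def y_def)
    have tf: "tensor_functional f t = t \<bullet> tensor_vec y" if "t \<in> ?W" for t
      by (rule tensor_functional_eq_inner[OF that]) (simp add: y_def riesz_vec_def)
    have onQ: "\<bar>t \<bullet> tensor_vec y\<bar> \<le> (\<Prod>i\<in>UNIV. r i)" if t: "t \<in> Q" for t
    proof (cases "\<exists>i. r i = 0")
      case True
      then obtain i where "r i = 0" by blast
      then have "y i \<bullet> y i = 0" using yb[OF yV, of i] inner_ge_zero[of "y i"] by (intro antisym) auto
      then have "y i = 0" by simp
      then have "tensor_vec y = 0" by (auto simp: tensor_vec_eq_0_iff)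
      then show ?thesis using r0 by (simp add: prod_nonneg)
    next
      case False
      then have pos: "0 < r i" for i using r0[of i] by (metis order_le_less)
      have "inverse (r i) *\<^sub>R y i \<in> polar (?V i) (?B i)" for i
        using yb[of _ i] pos[of i] yV[of i]
        by (auto simp: mem_polar_unit_ball_iff[OF N V] subspace_scale[OF V] abs_mult field_simps)
      then have "\<bar>t \<bullet> tensor_vec (\<lambda>i. inverse (r i) *\<^sub>R y i)\<bar> \<le> 1"
        using between t by (intro inj_tensorD[of t D ?B]) auto
      moreover have p: "0 < (\<Prod>i\<in>UNIV. r i)" using pos by (simp add: prod_pos)
      moreover have "(\<Prod>i\<in>UNIV. inverse (r i)) = inverse (\<Prod>i\<in>UNIV. r i)"
        using prod_inversef[of r UNIV] by (simp add: comp_def)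
      ultimately have "inverse (\<Prod>i\<in>UNIV. r i) * \<bar>t \<bullet> tensor_vec y\<bar> \<le> 1"
        by (simp add: tensor_vec_scale abs_mult)
      then show ?thesis using p by (simp add: field_simps)
    qed
    have bound: "\<bar>tensor_functional f t\<bar> \<le> (\<Prod>i\<in>UNIV. r i) * ?g t" if t: "t \<in> ?W" for t
      using bounded_on_unit_ball_imp[OF g W t, of "\<lambda>t. t \<bullet> tensor_vec y"] onQ
      by (simp add: tf t unit_ball_minkowski_functional[OF Q W])
    have "in_dual ?W ?g (tensor_functional f)"
      using bound linear_tensor_functional[of f]
      by (auto simp: in_dual_def linear_add linear_scale)
    moreover have "dual_norm ?W ?g (tensor_functional f) \<le> (\<Prod>i\<in>UNIV. r i)"
      using r0 by (intro dual_norm_leI[OF g W bound] prod_nonneg) auto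
    ultimately show ?thesis by (simp add: r_def)
  qed
  ultimately show ?cross using g by (simp add: reasonable_crossnorm_def)
qed

lemma tensorial_body_iff_reasonable_crossnorm:
  fixes D :: "'l::finite \<Rightarrow> 'n::finite set"
  assumes Q: "sym_convex_body (tensor_space D) Q"
  shows "tensorial_body D Q \<longleftrightarrow> (\<exists>N. (\<forall>i. norm_on (coord_space (D i)) (N i)) \<and>
    reasonable_crossnorm D N (minkowski_functional Q))"
proof
  note V = subspace_coord_space
  assume "tensorial_body D Q"
  then obtain P where P: "\<And>i. sym_convex_body (coord_space (D i)) (P i)"
    and "proj_tensor P \<subseteq> Q" "Q \<subseteq> inj_tensor D P" by (auto simp: tensorial_body_def)
  moreover have "(\<lambda>i. unit_ball (coord_space (D i)) (minkowski_functional (P i))) = P"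
    using unit_ball_minkowski_functional[OF P V] by blast
  moreover have N: "norm_on (coord_space (D i)) (minkowski_functional (P i))" for i
    by (rule norm_on_minkowski_functional[OF P V])
  ultimately have "reasonable_crossnorm D (\<lambda>i. minkowski_functional (P i)) (minkowski_functional Q)"
    using reasonable_crossnorm_iff_between[OF Q, of "\<lambda>i. minkowski_functional (P i)"] by simp
  then show "\<exists>N. (\<forall>i. norm_on (coord_space (D i)) (N i)) \<and>
    reasonable_crossnorm D N (minkowski_functional Q)"
    using N by (intro exI[of _ "\<lambda>i. minkowski_functional (P i)"]) simp
next
  assume "\<exists>N. (\<forall>i. norm_on (coord_space (D i)) (N i)) \<and>
    reasonable_crossnorm D N (minkowski_functional Q)"
  then obtain N where N: "\<And>i. norm_on (coord_space (D i)) (N i)"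
    and cross: "reasonable_crossnorm D N (minkowski_functional Q)" by blast
  show "tensorial_body D Q"
    using Q sym_convex_body_unit_ball[OF N subspace_coord_space]
      cross[unfolded reasonable_crossnorm_iff_between[OF Q N]]
    unfolding tensorial_body_def
    by (intro conjI exI[of _ "\<lambda>i. unit_ball (coord_space (D i)) (N i)"]) auto
qed

text \<open>
  If \<open>y\<^sub>i\<close> norms \<open>x\<^sub>i\<close>, then the product of the \<open>y\<^sub>i\<close> is bounded by the crossnorm, and at the product
  of the \<open>x\<^sub>i\<close> it takes the value \<open>\<Prod>i. N i (x i)\<close>.
\<close>
lemma reasonable_crossnorm_tensor_vec:
  fixes D :: "'l::finite \<Rightarrow> 'n::finite set"
  assumes Q: "sym_convex_body (tensor_space D) Q"
    and N: "\<And>i. norm_on (coord_space (D i)) (N i)"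
    and cross: "reasonable_crossnorm D N (minkowski_functional Q)"
    and x: "\<And>i. x i \<in> coord_space (D i)"
  shows "minkowski_functional Q (tensor_vec x) = (\<Prod>i\<in>UNIV. N i (x i))"
proof (rule antisym)
  let ?g = "minkowski_functional Q" and ?B = "\<lambda>i. unit_ball (coord_space (D i)) (N i)"
  note V = subspace_coord_space and W = subspace_tensor_space[of D]
  show "?g (tensor_vec x) \<le> (\<Prod>i\<in>UNIV. N i (x i))"
    using cross x by (simp add: reasonable_crossnorm_def)
  have "\<exists>y. y \<in> polar (coord_space (D i)) (?B i) \<and> x i \<bullet> y = N i (x i)" for i
    using norming_functional[OF N V x] by metis
  then obtain y where y: "\<And>i. y i \<in> polar (coord_space (D i)) (?B i)" "\<And>i. x i \<bullet> y i = N i (x i)"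
    by metis
  have onQ: "\<bar>t \<bullet> tensor_vec y\<bar> \<le> 1" if "t \<in> Q" for t
    using that y(1) cross[unfolded reasonable_crossnorm_iff_between[OF Q N]]
    by (intro inj_tensorD[of t D ?B]) auto
  have "\<bar>tensor_vec x \<bullet> tensor_vec y\<bar> \<le> 1 * ?g (tensor_vec x)"
    by (rule bounded_on_unit_ball_imp[OF norm_on_minkowski_functional[OF Q W] W
        tensor_vec_in_tensor_space[OF x], where f = "\<lambda>t. t \<bullet> tensor_vec y"])
      (use onQ in \<open>auto simp: unit_ball_minkowski_functional[OF Q W]\<close>)
  then show "(\<Prod>i\<in>UNIV. N i (x i)) \<le> ?g (tensor_vec x)"
    by (simp add: inner_tensor_vec y(2))
qed


section \<open>Slices through a decomposable boundary point\<close>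

text \<open>
  The slice is the unit ball of \<open>x \<mapsto> g\<^sub>Q (a\<^sub>1 \<otimes> \<dots> \<otimes> x \<otimes> \<dots> \<otimes> a\<^sub>l)\<close>.  This is a norm because the map
  inserting \<open>x\<close> is linear, and injective as no \<open>a\<^sub>j\<close> is 0.
\<close>
lemma sym_convex_body_slice:
  fixes D :: "'l::finite \<Rightarrow> 'n::finite set"
  assumes Q: "sym_convex_body (tensor_space D) Q"
    and a: "\<And>i. a i \<in> coord_space (D i)" and nz: "tensor_vec a \<noteq> 0"
  shows "sym_convex_body (coord_space (D i)) (slice D Q a i)"
proof -
  let ?V = "coord_space (D i)" and ?n = "\<lambda>x. minkowski_functional Q (tensor_vec (a(i := x)))"
  note W = subspace_tensor_space[of D] and V = subspace_coord_space
  note g = norm_on_minkowski_functional[OF Q W]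
  have mem: "tensor_vec (a(i := x)) \<in> tensor_space D" if "x \<in> ?V" for x
    using a that by (intro tensor_vec_in_tensor_space) auto
  have zero_iff: "tensor_vec (a(i := x)) = 0 \<longleftrightarrow> x = 0" for x
    using nz unfolding tensor_vec_eq_0_iff by (metis fun_upd_apply)
  have "norm_on ?V ?n"
    unfolding norm_on_def
  proof (intro conjI ballI allI)
    fix x y c assume x: "x \<in> ?V" and y: "y \<in> ?V"
    show "0 \<le> ?n x" by (rule norm_on_nonneg[OF g mem[OF x]])
    show "?n x = 0 \<longleftrightarrow> x = 0" unfolding norm_on_eq_0_iff[OF g mem[OF x]] by (rule zero_iff)
    show "?n (c *\<^sub>R x) = \<bar>c\<bar> * ?n x"
      unfolding tensor_vec_upd_scale by (rule norm_on_scale[OF g mem[OF x]])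
    show "?n (x + y) \<le> ?n x + ?n y"
      unfolding tensor_vec_upd_add by (rule norm_on_triangle[OF g mem[OF x] mem[OF y]])
  qed
  moreover have "slice D Q a i = unit_ball ?V ?n"
    using mem_iff_minkowski_functional[OF Q W mem] by (auto simp: slice_def unit_ball_def)
  ultimately show ?thesis by (simp add: sym_convex_body_unit_ball[OF _ V])
qed

text \<open>
  By multiplicativity the crossnorm of the vector with \<open>x\<close> in place of \<open>a\<^sub>i\<close> is \<open>N\<^sub>i x\<close> times the
  product of the remaining \<open>N\<^sub>j a\<^sub>j\<close>, and that product is \<open>1 / N\<^sub>i a\<^sub>i\<close>.
\<close>
lemma slice_eq_unit_ball:
  fixes D :: "'l::finite \<Rightarrow> 'n::finite set"
  assumes Q: "sym_convex_body (tensor_space D) Q"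
    and N: "\<And>i. norm_on (coord_space (D i)) (N i)"
    and cross: "reasonable_crossnorm D N (minkowski_functional Q)"
    and a: "\<And>i. a i \<in> coord_space (D i)" and a1: "(\<Prod>j\<in>UNIV. N j (a j)) = 1"
  shows "slice D Q a i = unit_ball (coord_space (D i)) (\<lambda>x. 1 / N i (a i) * N i x)"
proof -
  have split: "N i (a i) * (\<Prod>j\<in>UNIV - {i}. N j (a j)) = 1"
    unfolding a1[symmetric] by (rule prod.remove[OF finite UNIV_I, symmetric])
  have rest: "(\<Prod>j\<in>UNIV - {i}. N j (a j)) = 1 / N i (a i)"
    unfolding inverse_eq_divide[symmetric] by (rule inverse_unique[OF split, symmetric])
  have "tensor_vec (a(i := x)) \<in> Q \<longleftrightarrow> 1 / N i (a i) * N i x \<le> 1" if x: "x \<in> coord_space (D i)" for x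
  proof -
    have xV: "(a(i := x)) j \<in> coord_space (D j)" for j using x a by simp
    have "minkowski_functional Q (tensor_vec (a(i := x))) = (\<Prod>j\<in>UNIV. N j ((a(i := x)) j))"
      by (rule reasonable_crossnorm_tensor_vec[OF Q N cross xV])
    also have "\<dots> = N i x * (\<Prod>j\<in>UNIV - {i}. N j ((a(i := x)) j))"
      by (subst prod.remove[of UNIV i]) simp_all
    also have "(\<Prod>j\<in>UNIV - {i}. N j ((a(i := x)) j)) = (\<Prod>j\<in>UNIV - {i}. N j (a j))"
      by (intro prod.cong) auto
    also have "N i x * (\<Prod>j\<in>UNIV - {i}. N j (a j)) = 1 / N i (a i) * N i x"
      unfolding rest by simp
    finally have "minkowski_functional Q (tensor_vec (a(i := x))) = 1 / N i (a i) * N i x" .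
    moreover have "tensor_vec (a(i := x)) \<in> tensor_space D"
      by (rule tensor_vec_in_tensor_space[OF xV])
    ultimately show ?thesis
      using mem_iff_minkowski_functional[OF Q subspace_tensor_space] by metis
  qed
  then show ?thesis by (auto simp: slice_def unit_ball_def)
qed

lemma norm_on_scaled: "norm_on V N \<Longrightarrow> 0 < c \<Longrightarrow> norm_on V (\<lambda>x. c * N x)"
  by (auto simp: norm_on_def simp flip: distrib_left)

text \<open>
  The slices are the unit balls dilated by the factors \<open>N\<^sub>i a\<^sub>i\<close>, so their polars are dilated by the
  inverse factors.  A decomposable vector only sees the product of such factors, which is 1.
\<close>
lemma between_slices:
  fixes D :: "'l::finite \<Rightarrow> 'n::finite set"
  assumes Q: "sym_convex_body (tensor_space D) Q"
    and N: "\<And>i. norm_on (coord_space (D i)) (N i)"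
    and cross: "reasonable_crossnorm D N (minkowski_functional Q)"
    and a: "\<And>i. a i \<in> coord_space (D i)" and a1: "(\<Prod>j\<in>UNIV. N j (a j)) = 1"
  shows "proj_tensor (slice D Q a) \<subseteq> Q \<and> Q \<subseteq> inj_tensor D (slice D Q a)"
proof
  let ?V = "\<lambda>i. coord_space (D i)"
  let ?B = "\<lambda>i. unit_ball (?V i) (N i)"
  note W = subspace_tensor_space[of D] and V = subspace_coord_space
  have Q': "convex Q" "Q \<subseteq> tensor_space D" using Q by (auto simp: sym_convex_body_def)
  have pos: "0 < N i (a i)" for i
  proof -
    have "N i (a i) \<noteq> 0" using prod_zero[of UNIV "\<lambda>j. N j (a j)"] a1 by auto
    then show ?thesis using norm_on_nonneg[OF N a, of i] by linarith
  qed
  have mem_slice: "x \<in> slice D Q a i \<longleftrightarrow> x \<in> ?V i \<and> N i x \<le> N i (a i)" for x i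
    using pos[of i] by (simp add: slice_eq_unit_ball[OF Q N cross a a1] unit_ball_def field_simps)
  show "proj_tensor (slice D Q a) \<subseteq> Q"
    unfolding proj_tensor_subset_iff[OF Q'(1)]
  proof (intro allI impI)
    fix x assume x: "\<forall>i. x i \<in> slice D Q a i"
    then have xV: "\<And>i. x i \<in> ?V i" by (simp add: mem_slice)
    have "(\<Prod>i\<in>UNIV. N i (x i)) \<le> (\<Prod>i\<in>UNIV. N i (a i))"
      using x norm_on_nonneg[OF N] by (intro prod_mono) (auto simp: mem_slice)
    then show "tensor_vec x \<in> Q"
      using mem_iff_minkowski_functional[OF Q W tensor_vec_in_tensor_space[OF xV]]
        reasonable_crossnorm_tensor_vec[OF Q N cross xV] a1 by simp
  qed
  show "Q \<subseteq> inj_tensor D (slice D Q a)"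
  proof
    fix t assume t: "t \<in> Q"
    have "\<bar>t \<bullet> tensor_vec y\<bar> \<le> 1" if y: "\<forall>i. y i \<in> polar (?V i) (slice D Q a i)" for y
    proof -
      have "N i (a i) *\<^sub>R y i \<in> polar (?V i) (?B i)" for i
      proof -
        have "\<bar>x \<bullet> (N i (a i) *\<^sub>R y i)\<bar> \<le> 1" if x: "x \<in> ?B i" for x
        proof -
          have "N i (a i) *\<^sub>R x \<in> slice D Q a i"
            using x pos[of i]
            by (auto simp: mem_slice unit_ball_def subspace_scale[OF V] norm_on_scale[OF N])
          then have "\<bar>(N i (a i) *\<^sub>R x) \<bullet> y i\<bar> \<le> 1" using y unfolding mem_polar_iff by blast
          then show ?thesis by simp
        qed
        then show ?thesis using y by (simp add: mem_polar_iff subspace_scale[OF V])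
      qed
      then have "\<bar>t \<bullet> tensor_vec (\<lambda>i. N i (a i) *\<^sub>R y i)\<bar> \<le> 1"
        using t cross[unfolded reasonable_crossnorm_iff_between[OF Q N]]
        by (intro inj_tensorD[of t D ?B]) auto
      then show ?thesis by (simp add: tensor_vec_scale a1)
    qed
    then show "t \<in> inj_tensor D (slice D Q a)" using t Q' by (auto simp: mem_inj_tensor_iff)
  qed
qed

text \<open>
  A product of coordinate vectors is nonzero, and normalising a single factor of it suffices.  As
  the factors are nontrivial, the condition on slices is therefore never vacuous.
\<close>
lemma decomposable_boundary_point_exists:
  fixes D :: "'l::finite \<Rightarrow> 'n::finite set"
  assumes D: "\<And>i. D i \<noteq> {}" and g: "norm_on (tensor_space D) \<alpha>"
  obtains a where "\<And>i. a i \<in> coord_space (D i)" "\<alpha> (tensor_vec a) = 1"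
proof -
  have "\<forall>i. \<exists>j. j \<in> D i" using D by blast
  then obtain k where k: "\<And>i. k i \<in> D i" by metis
  define b where "b i = (axis (k i) 1 :: real ^ 'n)" for i
  have b: "b i \<in> coord_space (D i)" for i using k[of i] by (auto simp: b_def coord_space_def axis_def)
  have mem: "tensor_vec b \<in> tensor_space D" by (rule tensor_vec_in_tensor_space[OF b])
  have pos: "0 < \<alpha> (tensor_vec b)"
    by (rule norm_on_pos[OF g mem]) (simp add: tensor_vec_eq_0_iff b_def axis_eq_0_iff)
  fix i0 :: 'l
  define a where "a = b(i0 := inverse (\<alpha> (tensor_vec b)) *\<^sub>R b i0)"
  have "a i \<in> coord_space (D i)" for i using b by (simp add: a_def subspace_scale[OF subspace_coord_space])
  moreover have "\<alpha> (tensor_vec a) = 1"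
    using pos by (simp add: a_def tensor_vec_upd_scale norm_on_scale[OF g mem])
  ultimately show thesis by (rule that)
qed

theorem corollary3p4:
  fixes D :: "'l::finite \<Rightarrow> 'n::finite set"
    and Q :: "(real ^ ('l \<Rightarrow> 'n)) set"
  assumes "\<And>i. D i \<noteq> {}"
    and "sym_convex_body (tensor_space D) Q"
  shows "(tensorial_body D Q \<longleftrightarrow>
           (\<forall>a. (\<forall>i. a i \<in> coord_space (D i)) \<and>
                tensor_vec a \<in> (top_of_set (tensor_space D)) frontier_of Q \<longrightarrow>
                proj_tensor (slice D Q a) \<subseteq> Q \<and> Q \<subseteq> inj_tensor D (slice D Q a)))
       \<and> (tensorial_body D Q \<longleftrightarrow>
           (\<exists>N. (\<forall>i. norm_on (coord_space (D i)) (N i)) \<and>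
                reasonable_crossnorm D N (minkowski_functional Q)))
       \<and> (\<forall>N a. (\<forall>i. norm_on (coord_space (D i)) (N i)) \<and>
                reasonable_crossnorm D N (minkowski_functional Q) \<and>
                (\<forall>i. a i \<in> coord_space (D i)) \<and>
                tensor_vec a \<in> (top_of_set (tensor_space D)) frontier_of Q \<longrightarrow>
                (\<forall>i. \<forall>x\<in>coord_space (D i).
                   minkowski_functional (slice D Q a i) x = 1 / N i (a i) * N i x))"
proof (intro conjI)
  note Q = assms(2) and W = subspace_tensor_space[of D] and V = subspace_coord_space
  note g = norm_on_minkowski_functional[OF Q W]
  note frontier = frontier_of_sym_convex_body[OF Q W]
  show char3: "tensorial_body D Q \<longleftrightarrow> (\<exists>N. (\<forall>i. norm_on (coord_space (D i)) (N i)) \<and>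
      reasonable_crossnorm D N (minkowski_functional Q))"
    by (rule tensorial_body_iff_reasonable_crossnorm[OF Q])
  have prod1: "(\<Prod>i\<in>UNIV. N i (a i)) = 1"
    if "\<And>i. norm_on (coord_space (D i)) (N i)" "reasonable_crossnorm D N (minkowski_functional Q)"
      "\<And>i. a i \<in> coord_space (D i)" "tensor_vec a \<in> (top_of_set (tensor_space D)) frontier_of Q" for N a
    using reasonable_crossnorm_tensor_vec[OF Q that(1-3)] that(4) by (simp add: frontier)
  show "tensorial_body D Q \<longleftrightarrow>
     (\<forall>a. (\<forall>i. a i \<in> coord_space (D i)) \<and>
          tensor_vec a \<in> (top_of_set (tensor_space D)) frontier_of Q \<longrightarrow>
          proj_tensor (slice D Q a) \<subseteq> Q \<and> Q \<subseteq> inj_tensor D (slice D Q a))"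
    (is "_ \<longleftrightarrow> ?slices")
  proof
    assume "tensorial_body D Q"
    then obtain N where N: "\<And>i. norm_on (coord_space (D i)) (N i)"
      "reasonable_crossnorm D N (minkowski_functional Q)" unfolding char3 by blast
    show ?slices
    proof (intro allI impI, elim conjE)
      fix a assume "\<forall>i. a i \<in> coord_space (D i)"
        and fr: "tensor_vec a \<in> (top_of_set (tensor_space D)) frontier_of Q"
      then have a: "\<And>i. a i \<in> coord_space (D i)" by simp
      show "proj_tensor (slice D Q a) \<subseteq> Q \<and> Q \<subseteq> inj_tensor D (slice D Q a)"
        by (rule between_slices[OF Q N a prod1[OF N a fr]])
    qed
  next
    assume slices: ?slices
    obtain a where a: "\<And>i. a i \<in> coord_space (D i)" "minkowski_functional Q (tensor_vec a) = 1"
      using decomposable_boundary_point_exists[OF assms(1) g] by blast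
    have mem: "tensor_vec a \<in> tensor_space D" by (rule tensor_vec_in_tensor_space[OF a(1)])
    have "tensor_vec a \<noteq> 0" using norm_on_eq_0_iff[OF g mem] a(2) by auto
    from sym_convex_body_slice[OF Q a(1) this] show "tensorial_body D Q"
      using slices a mem Q unfolding tensorial_body_def frontier by blast
  qed
  show "\<forall>N a. (\<forall>i. norm_on (coord_space (D i)) (N i)) \<and>
          reasonable_crossnorm D N (minkowski_functional Q) \<and>
          (\<forall>i. a i \<in> coord_space (D i)) \<and>
          tensor_vec a \<in> (top_of_set (tensor_space D)) frontier_of Q \<longrightarrow>
          (\<forall>i. \<forall>x\<in>coord_space (D i).
             minkowski_functional (slice D Q a i) x = 1 / N i (a i) * N i x)"
  proof (intro allI impI ballI, elim conjE)
    fix N a i x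
    assume "\<forall>i. norm_on (coord_space (D i)) (N i)" "\<forall>i. a i \<in> coord_space (D i)"
      and cross: "reasonable_crossnorm D N (minkowski_functional Q)"
      and fr: "tensor_vec a \<in> (top_of_set (tensor_space D)) frontier_of Q"
      and x: "x \<in> coord_space (D i)"
    then have N: "\<And>i. norm_on (coord_space (D i)) (N i)" and a: "\<And>i. a i \<in> coord_space (D i)"
      by auto
    note a1 = prod1[OF N cross a fr]
    have "N i (a i) \<noteq> 0" using prod_zero[of UNIV "\<lambda>j. N j (a j)"] a1 by auto
    then have "0 < 1 / N i (a i)" using norm_on_nonneg[OF N a, of i] by simp
    from minkowski_functional_unit_ball[OF norm_on_scaled[OF N this] V x]
    show "minkowski_functional (slice D Q a i) x = 1 / N i (a i) * N i x"
      by (simp add: slice_eq_unit_ball[OF Q N cross a a1])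
  qed
qed

end
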